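(* $$\mathrm{h}_{ord}(n)=\left\lfloor \frac{n^{2}}{4} \right\rfloor.$$
   Context: For a set $A$ of $n$ irrational real numbers $a_1< a_2< \ldots< a_n$, let $\mathcal{H}_{ord}(A)$ denote the set of subsets $A'$ of the form $A'=A\cap I$ for which $\sum_{x\in A'} x\in \mathbb{Q}$ and $I\subset \mathbb{R}$ is an interval. Define $\mathrm{h}_{ord}(n):=\max_{A} |\mathcal{H}_{ord}(A)|$, the maximum being over all sets $A$ of $n$ irrational real numbers.
   Formalization: Only nonempty subsets A' are counted in H_ord(A); with the empty set (sum 0, rational) included, as the definition literally reads, the maximum would be floor(n^2/4)+1, for example 1 instead of 0 for n = 1. *)

theory Defs
  imports "HOL-Analysis.Analysis"
begin

text \<open>The empty set (with empty sum \<open>0\<close>) is not counted among the rational-sum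
  subsets: counting it would add one to every cardinality below, and the value for
  \<open>n = 1\<close> would be \<open>1\<close>, not \<open>0\<close>.\<close>

definition H_ord :: "real set \<Rightarrow> real set set" where
  "H_ord A = {A'. A' \<noteq> {} \<and> (\<exists>I. is_interval I \<and> A' = A \<inter> I) \<and> (\<Sum>x\<in>A'. x) \<in> \<rat>}"

definition irrational_sets :: "nat \<Rightarrow> real set set" where
  "irrational_sets n = {A. finite A \<and> card A = n \<and> A \<inter> \<rat> = {}}"

definition h_ord :: "nat \<Rightarrow> nat" where
  "h_ord n = Max ((\<lambda>A. card (H_ord A)) ` irrational_sets n)"

text \<open>The next two facts show that the maximum is taken over a finite nonempty set,
  so that \<^const>\<open>Max\<close> is a genuine, attained maximum.\<close>

lemma finite_card_H_ord_image: "finite ((\<lambda>A. card (H_ord A)) ` irrational_sets n)"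
proof (rule finite_subset)
  show "(\<lambda>A. card (H_ord A)) ` irrational_sets n \<subseteq> {..2 ^ n}"
  proof (rule image_subsetI)
    fix A assume A: "A \<in> irrational_sets n"
    then have "finite A" "card A = n"
      by (auto simp: irrational_sets_def)
    moreover have "H_ord A \<subseteq> Pow A"
      by (auto simp: H_ord_def)
    ultimately show "card (H_ord A) \<in> {..2 ^ n}"
      by (metis atMost_iff card_Pow card_mono finite_Pow_iff)
  qed
qed simp

lemma irrational_sets_nonempty: "irrational_sets n \<noteq> {}"
proof -
  have "uncountable (- \<rat> :: real set)"
    using uncountable_minus_countable[OF uncountable_UNIV_real countable_rat]
    by (simp add: Compl_eq_Diff_UNIV)
  then have "infinite (- \<rat> :: real set)"
    using countable_finite by blast
  then obtain A :: "real set" where "A \<subseteq> - \<rat>" "finite A" "card A = n"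
    using infinite_arbitrarily_large by blast
  then show ?thesis
    by (auto simp: irrational_sets_def)
qed

end

theory Submission
  imports Defs
begin

text \<open>
  Write \<open>A = {a 0 < \<dots> < a (n - 1)}\<close> and let \<open>s j\<close> be the sum of the first \<open>j\<close> elements. A
  nonempty \<open>A \<inter> I\<close> is a block of consecutive elements, and its sum is a difference \<open>s j - s i\<close>
  with \<open>i < j \<le> n\<close>. So \<^term>\<open>card (H_ord A)\<close> counts the pairs \<open>i < j\<close> for which \<open>s i\<close> and \<open>s j\<close>
  lie in the same coset of \<open>\<rat>\<close> (\<open>card_H_ord_eq_sum\<close>).

  Irrationality of the elements says exactly that neighbouring partial sums lie in different cosets.
  Hence, for fixed \<open>j\<close>, the admissible indices \<open>i\<close> are at most \<open>j - 2\<close> and no two of them are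
  neighbours, so there are at most \<open>j div 2\<close> of them (\<open>card_rational_blocks_le\<close>). Summing over
  \<open>j \<le> n\<close> gives \<open>n\<^sup>2 div 4\<close>. Equality holds for every \<open>j\<close> simultaneously if the coset of \<open>s j\<close>
  depends only on the parity of \<open>j\<close>; this happens when the irrational parts of the elements
  alternate between \<open>t\<close> and \<open>- t\<close> (\<open>alternating_set_attains\<close>).
\<close>

text \<open>Convexity of \<open>I\<close> forces the indices of the elements in \<open>A \<inter> I\<close> to fill the whole range from
  the least to the greatest of them. Conversely a block is cut out by the closed interval between
  its end elements.\<close>

lemma interval_traces_eq_blocks:
  fixes a :: "nat \<Rightarrow> real"
  assumes a: "strict_mono_on {..<n} a"
  shows "{A'. A' \<noteq> {} \<and> (\<exists>I. is_interval I \<and> A' = a ` {..<n} \<inter> I)}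
       = {a ` {i..<j} |i j. i < j \<and> j \<le> n}" (is "?L = ?R")
proof (intro equalityI subsetI)
  fix A' assume "A' \<in> ?L"
  then obtain I where I: "is_interval I" "A' = a ` {..<n} \<inter> I" "A' \<noteq> {}"
    by auto
  define P where "P = {k. k < n \<and> a k \<in> I}"
  have A': "A' = a ` P"
    using I by (auto simp: P_def)
  have P: "finite P" "P \<noteq> {}"
    using I A' by (auto simp: P_def)
  note ends = Min_in[OF P] Max_in[OF P]
  have "P = {Min P..<Suc (Max P)}"
  proof (intro equalityI subsetI)
    fix k assume "k \<in> P"
    then show "k \<in> {Min P..<Suc (Max P)}"
      using P by (auto simp: less_Suc_eq_le)
  next
    fix k assume k: "k \<in> {Min P..<Suc (Max P)}"
    then have "k < n"
      using ends by (auto simp: P_def)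
    moreover have "a (Min P) \<le> a k" "a k \<le> a (Max P)"
      using k ends \<open>k < n\<close>
      by (auto simp: P_def intro!: strict_mono_on_leD[OF a])
    then have "a k \<in> I"
      using I(1) ends unfolding is_interval_1 P_def by blast
    ultimately show "k \<in> P"
      by (simp add: P_def)
  qed
  moreover have "Min P < Suc (Max P)" "Suc (Max P) \<le> n"
    using ends P by (simp_all add: P_def less_Suc_eq_le Suc_le_eq)
  ultimately show "A' \<in> ?R"
    using A' by blast
next
  fix A' assume "A' \<in> ?R"
  then obtain i j where ij: "i < j" "j \<le> n" "A' = a ` {i..<j}"
    by auto
  have "A' = a ` {..<n} \<inter> {a i..a (j - 1)}"
  proof -
    have "k \<in> {i..<j} \<longleftrightarrow> a i \<le> a k \<and> a k \<le> a (j - 1)" if "k < n" for k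
      using that ij by (auto simp: strict_mono_on_less_eq[OF a])
    moreover have "k < n" if "k \<in> {i..<j}" for k
      using that ij by simp
    ultimately show ?thesis
      unfolding ij(3) by fastforce
  qed
  then show "A' \<in> ?L"
    using ij by (auto intro: is_interval_cc)
qed

lemma card_H_ord_eq_sum:
  fixes a :: "nat \<Rightarrow> real"
  assumes a: "strict_mono_on {..<n} a"
  shows "card (H_ord (a ` {..<n})) = (\<Sum>j\<le>n. card {i. i < j \<and> sum a {i..<j} \<in> \<rat>})"
proof -
  have inj: "inj_on a {..<n}"
    using a by (rule strict_mono_on_imp_inj_on)
  define Q where "Q = Sigma {..n} (\<lambda>j. {i. i < j \<and> sum a {i..<j} \<in> \<rat>})"
  have block_sum: "\<Sum>(a ` {i..<j}) = sum a {i..<j}" if "j \<le> n" for i j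
    using that by (subst sum.reindex) (auto intro: inj_on_subset[OF inj])
  have "H_ord (a ` {..<n}) = {A' \<in> {a ` {i..<j} |i j. i < j \<and> j \<le> n}. \<Sum>A' \<in> \<rat>}"
    unfolding H_ord_def interval_traces_eq_blocks[OF a, symmetric] by auto
  also have "\<dots> = (\<lambda>(j, i). a ` {i..<j}) ` Q"
    by (force simp: Q_def block_sum)
  finally have eq: "H_ord (a ` {..<n}) = (\<lambda>(j, i). a ` {i..<j}) ` Q" .
  have "inj_on (\<lambda>(j, i). a ` {i..<j}) Q"
  proof (rule inj_onI, clarify)
    fix i j i' j'
    assume Q: "(j, i) \<in> Q" "(j', i') \<in> Q" and "a ` {i..<j} = a ` {i'..<j'}"
    then have "{i..<j} = {i'..<j'}"
      by (subst (asm) inj_on_image_eq_iff[OF inj]) (auto simp: Q_def)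
    then show "j = j' \<and> i = i'"
      using Q by (auto simp: Q_def atLeastLessThan_eq_iff)
  qed
  then have "card (H_ord (a ` {..<n})) = card Q"
    unfolding eq by (rule card_image)
  then show ?thesis
    by (simp add: Q_def card_SigmaI)
qed

text \<open>Group the possible left ends into the pairs \<open>{0, 1}, {2, 3}, \<dots>\<close>. If both members of a pair
  started a block with right end \<open>j\<close> and rational sum, the element by which the two blocks differ
  would be rational. The left end \<open>j - 1\<close> never occurs, its block being a single element, so only
  \<open>j div 2\<close> pairs matter.\<close>

lemma card_rational_blocks_le:
  fixes a :: "nat \<Rightarrow> real"
  assumes irr: "\<And>k. k < j \<Longrightarrow> a k \<notin> \<rat>"
  shows "card {i. i < j \<and> sum a {i..<j} \<in> \<rat>} \<le> j div 2"
proof -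
  define S where "S = {i. i < j \<and> sum a {i..<j} \<in> \<rat>}"
  have apart: "Suc i \<notin> S" if "i \<in> S" for i
  proof
    assume "Suc i \<in> S"
    then have "sum a {i..<j} - sum a {Suc i..<j} \<in> \<rat>"
      using that by (auto simp: S_def)
    moreover have "sum a {i..<j} = a i + sum a {Suc i..<j}"
      using that by (simp add: S_def sum.atLeast_Suc_lessThan)
    ultimately show False
      using irr[of i] that by (simp add: S_def)
  qed
  have bound: "Suc i < j" if "i \<in> S" for i
  proof (rule ccontr)
    assume "\<not> Suc i < j"
    then have "j = Suc i"
      using that by (simp add: S_def)
    then show False
      using that irr[of i] by (simp add: S_def)
  qed
  have "inj_on (\<lambda>i. i div 2) S"
  proof (rule linorder_inj_onI)
    fix i i' assume "i < i'" "i \<in> S" "i' \<in> S"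
    moreover from this have "i' \<noteq> Suc i"
      using apart by blast
    ultimately show "i div 2 \<noteq> i' div 2"
      by linarith
  qed auto
  moreover have "(\<lambda>i. i div 2) ` S \<subseteq> {..<j div 2}"
    using bound by fastforce
  ultimately have "card S \<le> card {..<j div 2}"
    by (intro card_inj_on_le) auto
  then show ?thesis
    by (simp add: S_def)
qed

lemma sum_halves: "(\<Sum>j\<le>n. j div 2) = n\<^sup>2 div (4 :: nat)"
proof (induction n)
  case (Suc n)
  have "(Suc n)\<^sup>2 div 4 = n\<^sup>2 div 4 + Suc n div 2"
    by (cases "even n") (auto elim!: evenE oddE simp: power2_eq_square algebra_simps)
  with Suc show ?case
    by simp
qed simp

lemma card_H_ord_le:
  assumes "A \<in> irrational_sets n"
  shows "card (H_ord A) \<le> n\<^sup>2 div 4"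
proof -
  have A: "finite A" "card A = n" "A \<inter> \<rat> = {}"
    using assms by (auto simp: irrational_sets_def)
  define a where "a k = sorted_list_of_set A ! k" for k
  have a: "strict_mono_on {..<n} a"
    using strict_sorted_list_of_set[of A] A
    by (auto simp: a_def strict_mono_on_def intro: sorted_wrt_nth_less)
  have A_eq: "A = a ` {..<n}"
    using set_sorted_list_of_set[OF A(1)] A
    by (auto simp: a_def set_conv_nth simp del: set_sorted_list_of_set)
  have "card (H_ord A) = (\<Sum>j\<le>n. card {i. i < j \<and> sum a {i..<j} \<in> \<rat>})"
    unfolding A_eq using a by (rule card_H_ord_eq_sum)
  also have "\<dots> \<le> (\<Sum>j\<le>n. j div 2)"
  proof (intro sum_mono card_rational_blocks_le)
    fix j k assume "j \<in> {..n}" "k < j"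
    then have "a k \<in> A"
      by (auto simp: A_eq)
    with A(3) show "a k \<notin> \<rat>"
      by blast
  qed
  finally show ?thesis
    by (simp add: sum_halves)
qed

lemma ex_irrational_unit_interval: "\<exists>t :: real. t \<notin> \<rat> \<and> 0 < t \<and> t < 1"
proof -
  have "uncountable ({0<..<1} - \<rat> :: real set)"
    by (intro uncountable_minus_countable countable_rat) (simp add: uncountable_open_interval)
  then have "{0<..<1} - \<rat> \<noteq> ({} :: real set)"
    by (metis countable_empty)
  then show ?thesis
    by auto
qed

text \<open>The irrational parts of neighbouring elements cancel, so every block of even length has a
  rational sum, and \<open>j div 2\<close> of the blocks with right end \<open>j\<close> have even length. The rational parts
  \<open>2 * k\<close> only serve to make the sequence increasing, which works because \<open>0 < t < 1\<close>.\<close>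

lemma alternating_set_attains: "\<exists>A \<in> irrational_sets n. card (H_ord A) = n\<^sup>2 div 4"
proof -
  obtain t :: real where t: "t \<notin> \<rat>" "0 < t" "t < 1"
    using ex_irrational_unit_interval by blast
  define a :: "nat \<Rightarrow> real" where "a k = 2 * real k + (if even k then t else - t)" for k
  have "strict_mono a"
    using t by (intro strict_mono_Suc_iff[THEN iffD2]) (auto simp: a_def)
  then have mono: "strict_mono_on {..<n} a"
    by (simp add: strict_mono_on_def strict_mono_def)
  have irr: "a k \<notin> \<rat>" for k
  proof
    assume "a k \<in> \<rat>"
    then have "a k - 2 * real k \<in> \<rat>"
      by simp
    with t(1) show False
      by (auto simp: a_def split: if_splits)
  qed
  have even_block: "sum a {i..<i + 2 * m} \<in> \<rat>" for i m
  proof (induction m)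
    case (Suc m)
    have "sum a {i..<i + 2 * Suc m}
        = sum a {i..<i + 2 * m} + (2 * real (i + 2 * m) + 2 * real (Suc (i + 2 * m)))"
      by (simp add: a_def)
    with Suc show ?case
      by (metis Rats_add Rats_mult Rats_number_of Rats_of_nat)
  qed simp
  have "j div 2 \<le> card {i. i < j \<and> sum a {i..<j} \<in> \<rat>}" for j
  proof -
    \<comment> \<open>The left end \<open>j - 2 * Suc m\<close> belongs to the block of length \<open>2 * Suc m\<close>.\<close>
    have "(\<lambda>m. j - 2 * Suc m) ` {..<j div 2} \<subseteq> {i. i < j \<and> sum a {i..<j} \<in> \<rat>}"
    proof (rule image_subsetI)
      fix m assume "m \<in> {..<j div 2}"
      then have "j - 2 * Suc m + 2 * Suc m = j" "j - 2 * Suc m < j"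
        by auto
      then show "j - 2 * Suc m \<in> {i. i < j \<and> sum a {i..<j} \<in> \<rat>}"
        using even_block[of "j - 2 * Suc m" "Suc m"] by (simp only: mem_Collect_eq simp_thms)
    qed
    moreover have "inj_on (\<lambda>m. j - 2 * Suc m) {..<j div 2}"
      by (rule inj_onI) auto
    ultimately show ?thesis
      using card_inj_on_le[of _ "{..<j div 2}"] by fastforce
  qed
  then have "(\<Sum>j\<le>n. j div 2) \<le> card (H_ord (a ` {..<n}))"
    unfolding card_H_ord_eq_sum[OF mono] by (intro sum_mono)
  moreover have "a ` {..<n} \<in> irrational_sets n"
    using irr card_image[OF strict_mono_on_imp_inj_on[OF mono]]
    by (auto simp: irrational_sets_def)
  ultimately show ?thesis
    using card_H_ord_le[of "a ` {..<n}" n] by (auto simp: sum_halves intro!: antisym bexI)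
qed

theorem theorem1p12:
  fixes n :: nat
  shows "int (h_ord n) = \<lfloor>(real n)\<^sup>2 / 4\<rfloor>"
proof -
  have "h_ord n = n\<^sup>2 div 4"
    unfolding h_ord_def
  proof (rule Max_eqI[OF finite_card_H_ord_image])
    show "n\<^sup>2 div 4 \<in> (\<lambda>A. card (H_ord A)) ` irrational_sets n"
      using alternating_set_attains by force
  qed (use card_H_ord_le in auto)
  then show ?thesis
    using floor_divide_of_nat_eq[of "n\<^sup>2" 4, where ?'a = real] by simp
qed

end
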